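(* Let $0<q<p$ be real, $n\ge0$ an integer, $s>0$, and let $f:(0,\infty)\to\mathbb C$ be a function whose $(p,q)$-Laplace transform of the first kind $F(\sigma)=L_{p,q}\{f(t)\}(\sigma)$ converges at all the points $\sigma=(p/q)^k s$, $0\le k\le n$. Then $$L_{p,q}\{t^nf(t)\}(s)=(-1)^nq^{\binom n2}\,\frac{\partial_{p,q}^{\,n}}{\partial_{p,q}s^n}\left[F(q^{-n}s)\right].$$
   Context: Let $0<q<p$ be real numbers. For an integer $n\ge 0$, $[n]_{p,q}=\frac{p^n-q^n}{p-q}$, $[n]_{p,q}!=\prod_{k=1}^n[k]_{p,q}$, $[0]_{p,q}!=1$. The big $(p,q)$-exponential is the entire function $E_{p,q}(z)=\sum_{n\ge0}\frac{q^{\binom n2}}{[n]_{p,q}!}z^n$. The improper $(p,q)$-integral of $f$ is $\int_0^\infty f(x)\,d_{p,q}x=(p-q)\sum_{j=-\infty}^{\infty}\frac{q^j}{p^{j+1}}f\!\left(\frac{q^j}{p^{j+1}}\right)$; it converges if both the sum over $j\ge0$ and the sum over $j<0$ converge. The $(p,q)$-Laplace transform of the first kind is $L_{p,q}\{f(t)\}(s)=\int_0^\infty f(t)E_{p,q}(-qts)\,d_{p,q}t$, $s>0$. The $(p,q)$-derivative in $s$ is $\frac{\partial_{p,q}}{\partial_{p,q}s}g(s)=\frac{g(ps)-g(qs)}{(p-q)s}$ for $s\ne0$, and $\frac{\partial_{p,q}^{\,n}}{\partial_{p,q}s^n}$ is its $n$-fold iterate (identity for $n=0$). The expression $\frac{\partial_{p,q}^{\,n}}{\partial_{p,q}s^n}[F(q^{-n}s)]$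 means that the operator is applied to the function $s\mapsto F(q^{-n}s)$; it only involves the values of $F$ at the points $(p/q)^ks$, $0\le k\le n$. *)

theory Defs
  imports Complex_Main
begin

definition pq_bracket :: "real \<Rightarrow> real \<Rightarrow> nat \<Rightarrow> real" where
  "pq_bracket p q n = (p ^ n - q ^ n) / (p - q)"

definition pq_fact :: "real \<Rightarrow> real \<Rightarrow> nat \<Rightarrow> real" where
  "pq_fact p q n = (\<Prod>k=1..n. pq_bracket p q k)"

definition pq_big_exp :: "real \<Rightarrow> real \<Rightarrow> complex \<Rightarrow> complex" where
  "pq_big_exp p q z = (\<Sum>n. of_real (q ^ (n choose 2) / pq_fact p q n) * z ^ n)"

definition pq_node :: "real \<Rightarrow> real \<Rightarrow> int \<Rightarrow> real" where
  "pq_node p q j = q powi j / p powi (j + 1)"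

definition pq_term :: "real \<Rightarrow> real \<Rightarrow> (real \<Rightarrow> complex) \<Rightarrow> int \<Rightarrow> complex" where
  "pq_term p q f j = of_real (pq_node p q j) * f (pq_node p q j)"

text \<open>The two halves of the bilateral series are ordinary (possibly only conditionally
  convergent) series; the index \<open>j < 0\<close> is enumerated as \<open>j = - (i + 1)\<close> with \<open>i = 0, 1, 2, \<dots>\<close>.\<close>

definition pq_integral_converges :: "real \<Rightarrow> real \<Rightarrow> (real \<Rightarrow> complex) \<Rightarrow> bool" where
  "pq_integral_converges p q f \<longleftrightarrow>
     summable (\<lambda>i::nat. pq_term p q f (int i)) \<and>
     summable (\<lambda>i::nat. pq_term p q f (- (int i + 1)))"

text \<open>Meaningful only when \<^const>\<open>pq_integral_converges\<close> holds.\<close>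

definition pq_integral :: "real \<Rightarrow> real \<Rightarrow> (real \<Rightarrow> complex) \<Rightarrow> complex" where
  "pq_integral p q f = of_real (p - q) *
     ((\<Sum>i::nat. pq_term p q f (int i)) + (\<Sum>i::nat. pq_term p q f (- (int i + 1))))"

definition pq_laplace_integrand ::
    "real \<Rightarrow> real \<Rightarrow> (real \<Rightarrow> complex) \<Rightarrow> real \<Rightarrow> real \<Rightarrow> complex" where
  "pq_laplace_integrand p q f s t = f t * pq_big_exp p q (of_real (- q * t * s))"

definition pq_laplace_converges :: "real \<Rightarrow> real \<Rightarrow> (real \<Rightarrow> complex) \<Rightarrow> real \<Rightarrow> bool" where
  "pq_laplace_converges p q f s \<longleftrightarrow> pq_integral_converges p q (pq_laplace_integrand p q f s)"

text \<open>Functions on \<open>(0,\<infinity>)\<close> are represented by total functions; for \<open>0 < q < p\<close> all nodes are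
  positive, so the values of \<open>f\<close> elsewhere are irrelevant.\<close>

definition pq_laplace :: "real \<Rightarrow> real \<Rightarrow> (real \<Rightarrow> complex) \<Rightarrow> real \<Rightarrow> complex" where
  "pq_laplace p q f s = pq_integral p q (pq_laplace_integrand p q f s)"

text \<open>Meaningful only for \<open>s \<noteq> 0\<close>.\<close>

definition pq_deriv :: "real \<Rightarrow> real \<Rightarrow> (real \<Rightarrow> complex) \<Rightarrow> real \<Rightarrow> complex" where
  "pq_deriv p q g s = (g (p * s) - g (q * s)) / of_real ((p - q) * s)"

end

theory Submission
  imports Defs
begin

text \<open>
  Comparing coefficients gives \<open>E(p z) - E(q z) = (p - q) z E(q z)\<close>. With \<open>z = - t s\<close> this says
  that the difference quotient in \<open>s\<close> of the kernel \<open>E(- t s)\<close> is \<open>- t E(- q t s)\<close>, so multiplying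
  \<open>f\<close> by \<open>t\<close> turns \<open>F(s)\<close> into \<open>- D[F(s / q)]\<close>, termwise at each node. Iterating uses only the
  transforms at \<open>s\<close> and \<open>(p / q) s\<close>, and the factor \<open>q\<^sup>n\<close> picked up in each step comes from the
  scaling rule \<open>D\<^sup>n[g(a s)] = a\<^sup>n (D\<^sup>n g)(a s)\<close> at \<open>a = 1 / q\<close>.
\<close>

lemma choose_two_Suc: "Suc n choose 2 = (n choose 2) + n"
  by (simp add: numeral_2_eq_2)

lemma pq_bracket_pos:
  assumes "0 < q" "q < p" "0 < n"
  shows "0 < pq_bracket p q n"
  using assms by (auto simp: pq_bracket_def intro!: divide_pos_pos power_strict_mono)

text \<open>The gap, multiplied by \<open>p - q\<close>, is
  \<open>q * (p ^ n - q ^ n) \<ge> 0\<close>. The bound makes the factor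
  \<open>q ^ n / pq_bracket p q (Suc n)\<close> between consecutive coefficients at most
  \<open>(q / p) ^ n\<close>.\<close>

lemma pq_bracket_Suc_ge:
  assumes "0 < q" "q < p"
  shows "p ^ n \<le> pq_bracket p q (Suc n)"
proof -
  have "q * q ^ n \<le> q * p ^ n"
    using assms by (intro mult_left_mono power_mono) auto
  then have "p ^ n * (p - q) \<le> p ^ Suc n - q ^ Suc n"
    by (simp add: algebra_simps)
  then show ?thesis
    using assms by (simp add: pq_bracket_def pos_le_divide_eq)
qed

lemma pq_fact_Suc: "pq_fact p q (Suc n) = pq_fact p q n * pq_bracket p q (Suc n)"
  by (simp add: pq_fact_def)

lemma pq_fact_pos:
  assumes "0 < q" "q < p"
  shows "0 < pq_fact p q n"
  unfolding pq_fact_def using assms by (intro prod_pos) (auto intro: pq_bracket_pos)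

lemma pq_big_exp_coeff_Suc:
  "q ^ (Suc n choose 2) / pq_fact p q (Suc n) =
    q ^ (n choose 2) / pq_fact p q n * (q ^ n / pq_bracket p q (Suc n))"
  by (simp add: choose_two_Suc pq_fact_Suc power_add)

text \<open>Ratio test: consecutive terms have ratio at most \<open>(q / p) ^ n * norm z\<close>,
  which tends to 0 for every \<open>z\<close>.\<close>

lemma pq_big_exp_summable:
  fixes z :: complex
  assumes "0 < q" "q < p"
  shows "summable (\<lambda>n. of_real (q ^ (n choose 2) / pq_fact p q n) * z ^ n)"
proof -
  let ?a = "\<lambda>n. of_real (q ^ (n choose 2) / pq_fact p q n) * z ^ n"
  have "(\<lambda>n. (q / p) ^ n * norm z) \<longlonglongrightarrow> 0 * norm z"
    using assms by (intro tendsto_mult tendsto_const LIMSEQ_power_zero) auto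
  then have "eventually (\<lambda>n. (q / p) ^ n * norm z < 1 / 2) sequentially"
    by (intro order_tendstoD) auto
  then obtain N where N: "\<And>n. n \<ge> N \<Longrightarrow> (q / p) ^ n * norm z < 1 / 2"
    by (auto simp: eventually_sequentially)
  show ?thesis
  proof (rule summable_ratio_test[where c = "1 / 2" and N = N])
    fix n assume "N \<le> n"
    have pos: "0 < pq_bracket p q (Suc n)"
      using assms by (intro pq_bracket_pos) auto
    have "q ^ n / pq_bracket p q (Suc n) \<le> q ^ n / p ^ n"
      using assms pq_bracket_Suc_ge[of q p n] by (intro divide_left_mono) (auto simp: pos)
    then have "q ^ n / pq_bracket p q (Suc n) * norm z \<le> (q / p) ^ n * norm z"
      by (intro mult_right_mono) (auto simp: power_divide)
    also have "\<dots> \<le> 1 / 2"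
      using N[OF \<open>N \<le> n\<close>] by simp
    finally have ratio: "q ^ n / pq_bracket p q (Suc n) * norm z \<le> 1 / 2" .
    have "norm (?a (Suc n)) = (q ^ n / pq_bracket p q (Suc n) * norm z) * norm (?a n)"
      unfolding pq_big_exp_coeff_Suc using assms pos
      by (simp add: norm_mult norm_power norm_divide ac_simps)
    also have "\<dots> \<le> 1 / 2 * norm (?a n)"
      by (intro mult_right_mono ratio) auto
    finally show "norm (?a (Suc n)) \<le> 1 / 2 * norm (?a n)" .
  qed simp
qed

lemma pq_big_exp_diff:
  fixes z :: complex
  assumes "0 < q" "q < p"
  shows "pq_big_exp p q (of_real p * z) - pq_big_exp p q (of_real q * z) =
    of_real (p - q) * z * pq_big_exp p q (of_real q * z)"
proof -
  define c where "c n = q ^ (n choose 2) / pq_fact p q n" for n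
  have summ: "summable (\<lambda>n. of_real (c n) * w ^ n)" for w :: complex
    unfolding c_def by (rule pq_big_exp_summable[OF assms])
  let ?d = "\<lambda>n. of_real (c n) * (of_real p * z) ^ n - of_real (c n) * (of_real q * z) ^ n"
  have step: "?d (Suc n) = of_real (p - q) * z * (of_real (c n) * (of_real q * z) ^ n)" for n
  proof -
    have "p ^ Suc n - q ^ Suc n = pq_bracket p q (Suc n) * (p - q)"
      using assms by (simp add: pq_bracket_def)
    \<comment> \<open>The bracket that enters with \<open>c (Suc n)\<close> cancels; the remaining
      \<open>q ^ n\<close> turns \<open>z ^ n\<close> into the power of \<open>q z\<close>.\<close>
    then have eq: "c (Suc n) * (p ^ Suc n - q ^ Suc n) = c n * q ^ n * (p - q)"
      using pq_bracket_pos[OF assms, of "Suc n"]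
      unfolding c_def pq_big_exp_coeff_Suc by simp
    have "?d (Suc n) = of_real (c (Suc n) * (p ^ Suc n - q ^ Suc n)) * z ^ Suc n"
      by (simp add: power_mult_distrib algebra_simps)
    also have "\<dots> = of_real (p - q) * z * (of_real (c n) * (of_real q * z) ^ n)"
      unfolding eq by (simp add: power_mult_distrib ac_simps)
    finally show ?thesis .
  qed
  have "pq_big_exp p q (of_real p * z) - pq_big_exp p q (of_real q * z) = (\<Sum>n. ?d n)"
    unfolding pq_big_exp_def c_def[symmetric] by (intro suminf_diff summ)
  \<comment> \<open>The term at index 0 is \<open>c 0 - c 0 = 0\<close>, so the shift loses
    nothing.\<close>
  also have "\<dots> = (\<Sum>n. ?d (Suc n))"
    using suminf_split_head[OF summable_diff[OF summ summ], of "of_real p * z" "of_real q * z"]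
    by simp
  also have "\<dots> = (\<Sum>n. of_real (p - q) * z * (of_real (c n) * (of_real q * z) ^ n))"
    by (simp only: step)
  also have "\<dots> = of_real (p - q) * z * pq_big_exp p q (of_real q * z)"
    unfolding pq_big_exp_def c_def[symmetric] by (intro suminf_mult summ)
  finally show ?thesis .
qed

text \<open>Scaling and difference are bundled because the integrand of \<open>t f(t)\<close> will
  have exactly this shape.\<close>

lemma pq_term_scaled_diff:
  "pq_term p q (\<lambda>t. a * (f t - g t)) j = a * (pq_term p q f j - pq_term p q g j)"
  by (simp add: pq_term_def algebra_simps)

lemma pq_integral_converges_scaled_diff:
  assumes "pq_integral_converges p q f" "pq_integral_converges p q g"
  shows "pq_integral_converges p q (\<lambda>t. a * (f t - g t))"
  using assms unfolding pq_integral_converges_def pq_term_scaled_diff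
  by (auto intro!: summable_mult summable_diff)

lemma pq_integral_scaled_diff:
  assumes "pq_integral_converges p q f" "pq_integral_converges p q g"
  shows "pq_integral p q (\<lambda>t. a * (f t - g t)) = a * (pq_integral p q f - pq_integral p q g)"
  using assms unfolding pq_integral_converges_def pq_integral_def pq_term_scaled_diff
  by (simp add: suminf_mult summable_diff suminf_diff[symmetric] algebra_simps)

text \<open>At \<open>z = - t s\<close> the arguments \<open>p z\<close> and \<open>q z\<close> of
  the exponential are those of the kernel at \<open>(p / q) s\<close> and at
  \<open>s\<close>.\<close>

lemma pq_laplace_integrand_mult_arg:
  assumes "0 < q" "q < p" "s \<noteq> 0"
  shows "pq_laplace_integrand p q (\<lambda>t. of_real t * f t) s =
    (\<lambda>t. - 1 / of_real ((p - q) * s) *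
      (pq_laplace_integrand p q f (p / q * s) t - pq_laplace_integrand p q f s t))"
proof
  fix t
  let ?z = "of_real (- t * s) :: complex"
  have "pq_laplace_integrand p q f (p / q * s) t - pq_laplace_integrand p q f s t =
      f t * (pq_big_exp p q (of_real p * ?z) - pq_big_exp p q (of_real q * ?z))"
    using assms by (simp add: pq_laplace_integrand_def algebra_simps)
  also have "\<dots> = - of_real ((p - q) * s) * pq_laplace_integrand p q (\<lambda>t. of_real t * f t) s t"
    unfolding pq_big_exp_diff[OF assms(1,2)]
    by (simp add: pq_laplace_integrand_def algebra_simps)
  finally show "pq_laplace_integrand p q (\<lambda>t. of_real t * f t) s t = - 1 / of_real ((p - q) * s) *
      (pq_laplace_integrand p q f (p / q * s) t - pq_laplace_integrand p q f s t)"
    using assms by simp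
qed

lemma pq_laplace_converges_mult_arg:
  assumes "0 < q" "q < p" "s \<noteq> 0"
    and "pq_laplace_converges p q f s" "pq_laplace_converges p q f (p / q * s)"
  shows "pq_laplace_converges p q (\<lambda>t. of_real t * f t) s"
  using assms(4,5) unfolding pq_laplace_converges_def pq_laplace_integrand_mult_arg[OF assms(1-3)]
  by (intro pq_integral_converges_scaled_diff)

lemma pq_laplace_mult_arg:
  assumes "0 < q" "q < p" "s \<noteq> 0"
    and "pq_laplace_converges p q f s" "pq_laplace_converges p q f (p / q * s)"
  shows "pq_laplace p q (\<lambda>t. of_real t * f t) s =
    - pq_deriv p q (\<lambda>\<sigma>. pq_laplace p q f (\<sigma> / q)) s"
proof -
  have "pq_laplace p q (\<lambda>t. of_real t * f t) s =
      - 1 / of_real ((p - q) * s) * (pq_laplace p q f (p / q * s) - pq_laplace p q f s)"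
    using assms(4,5)
    unfolding pq_laplace_def pq_laplace_converges_def pq_laplace_integrand_mult_arg[OF assms(1-3)]
    by (intro pq_integral_scaled_diff)
  then show ?thesis
    using assms(1) by (simp add: pq_deriv_def)
qed

text \<open>Agreement at two points suffices. This matters because the induction hypothesis is
  available only where the transforms converge.\<close>

lemma pq_deriv_cong:
  assumes "g (p * s) = h (p * s)" "g (q * s) = h (q * s)"
  shows "pq_deriv p q g s = pq_deriv p q h s"
  using assms by (simp add: pq_deriv_def)

lemma pq_deriv_cmult: "pq_deriv p q (\<lambda>\<sigma>. c * g \<sigma>) s = c * pq_deriv p q g s"
  by (simp add: pq_deriv_def right_diff_distrib)

lemma pq_deriv_scale:
  assumes "a \<noteq> 0"
  shows "pq_deriv p q (\<lambda>\<sigma>. g (a * \<sigma>)) s = of_real a * pq_deriv p q g (a * s)"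
  using assms by (simp add: pq_deriv_def mult.left_commute)

text \<open>Iterating needs an equality of functions; at \<open>s = 0\<close> it holds because
  division by zero yields 0 on both sides.\<close>

lemma pq_deriv_funpow_scale:
  assumes "a \<noteq> 0"
  shows "(pq_deriv p q ^^ n) (\<lambda>\<sigma>. g (a * \<sigma>)) = (\<lambda>s. of_real (a ^ n) * (pq_deriv p q ^^ n) g (a * s))"
proof (induction n)
  case (Suc n)
  show ?case
    by (simp add: Suc pq_deriv_cmult pq_deriv_scale[OF assms, of p q "(pq_deriv p q ^^ n) g"])
      (simp add: ac_simps)
qed simp

theorem theorem3p9:
  fixes p q s :: real and n :: nat and f :: "real \<Rightarrow> complex"
  assumes "0 < q" and "q < p" and "0 < s"
    and "\<forall>k\<le>n. pq_laplace_converges p q f ((p / q) ^ k * s)"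
  shows "pq_laplace_converges p q (\<lambda>t. of_real (t ^ n) * f t) s \<and>
    pq_laplace p q (\<lambda>t. of_real (t ^ n) * f t) s =
      (- 1) ^ n * of_real (q ^ (n choose 2)) *
        (pq_deriv p q ^^ n) (\<lambda>\<sigma>. pq_laplace p q f (q powi (- int n) * \<sigma>)) s"
  using assms(3,4)
proof (induction n arbitrary: s)
  case 0
  then show ?case by (simp add: numeral_2_eq_2)
next
  case (Suc n)
  let ?g = "\<lambda>t. of_real (t ^ n) * f t"
  let ?c = "(- 1) ^ n * of_real (q ^ (n choose 2)) :: complex"
  let ?F = "\<lambda>m \<sigma>. pq_laplace p q f (q powi (- int m) * \<sigma>)"
  \<comment> \<open>The points \<open>k \<le> Suc n\<close> for \<open>s\<close> contain the points
    \<open>k \<le> n\<close> for both \<open>s\<close> and \<open>(p / q) s\<close>, so the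
    induction hypothesis applies at both.\<close>
  have "pq_laplace_converges p q f ((p / q) ^ k * s)"
    and "pq_laplace_converges p q f ((p / q) ^ k * (p / q * s))" if "k \<le> n" for k
    using that Suc.prems(2)[rule_format, of k] Suc.prems(2)[rule_format, of "Suc k"]
    by (simp_all add: ac_simps)
  then have IH1: "pq_laplace_converges p q ?g s"
      "pq_laplace p q ?g s = ?c * (pq_deriv p q ^^ n) (?F n) s"
    and IH2: "pq_laplace_converges p q ?g (p / q * s)"
      "pq_laplace p q ?g (p / q * s) = ?c * (pq_deriv p q ^^ n) (?F n) (p / q * s)"
    using Suc.IH[of s] Suc.IH[of "p / q * s"] Suc.prems(1) assms(1,2) by auto
  have F: "(\<lambda>\<sigma>. ?F n (1 / q * \<sigma>)) = ?F (Suc n)"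
    unfolding power_int_minus power_int_of_nat by (simp add: field_simps)
  \<comment> \<open>The scaling rule at \<open>a = 1 / q\<close>, solved for the right-hand
    derivative.\<close>
  have D: "(pq_deriv p q ^^ n) (?F n) (\<sigma> / q) = of_real (q ^ n) * (pq_deriv p q ^^ n) (?F (Suc n)) \<sigma>"
    for \<sigma>
    using assms(1) pq_deriv_funpow_scale[of "1 / q" n p q "?F n"]
    unfolding F by (simp add: power_divide)
  have g: "(\<lambda>t. of_real (t ^ Suc n) * f t) = (\<lambda>t. of_real t * ?g t)"
    by (simp add: mult.assoc)
  have "s \<noteq> 0"
    using Suc.prems(1) by simp
  note step = assms(1,2) this IH1(1) IH2(1)
  have "pq_laplace p q (\<lambda>t. of_real (t ^ Suc n) * f t) s =
      - pq_deriv p q (\<lambda>\<sigma>. pq_laplace p q ?g (\<sigma> / q)) s"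
    unfolding g by (rule pq_laplace_mult_arg[OF step])
  \<comment> \<open>The derivative evaluates at \<open>\<sigma> = p s\<close> and
    \<open>\<sigma> = q s\<close>, where \<open>\<sigma> / q\<close> is \<open>(p / q) s\<close> and
    \<open>s\<close>.\<close>
  also have "\<dots> = - pq_deriv p q (\<lambda>\<sigma>. ?c * (pq_deriv p q ^^ n) (?F n) (\<sigma> / q)) s"
    using IH1(2) IH2(2) assms(1) by (intro arg_cong[of _ _ uminus] pq_deriv_cong) simp_all
  also have "\<dots> = - (?c * of_real (q ^ n)) * (pq_deriv p q ^^ Suc n) (?F (Suc n)) s"
    unfolding D by (simp add: pq_deriv_cmult)
  also have "- (?c * of_real (q ^ n)) = (- 1) ^ Suc n * of_real (q ^ (Suc n choose 2))"
    by (simp add: choose_two_Suc power_add)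
  finally show ?case
    unfolding g using pq_laplace_converges_mult_arg[OF step] by blast
qed

end
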